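(* Let $\{(\boldsymbol{x}_i,y_i)\}_{i=1}^n$ with $\boldsymbol{x}_i\in\mathbb{R}^d$, $\|\boldsymbol{x}_i\|\le1$, $y_i\in\{-1,+1\}$ be linearly separable. Let $\ell:\mathbb{R}\to\mathbb{R}$ be convex, differentiable and strictly decreasing to $0$, and suppose that for some $a,b>0$, $$\lim_{z\to\infty}\frac{\ell(z)}{a\exp(-bz)}=1.$$ For $B>0$ let $\bar{\boldsymbol{w}}(B)=\arg\min_{\|\boldsymbol{w}\|\le B}\mathcal{R}(\boldsymbol{w})$ where $\mathcal{R}(\boldsymbol{w})=\frac1n\sum_{i=1}^n\ell(y_i\langle\boldsymbol{w},\boldsymbol{x}_i\rangle)$. Then $\lim_{B\to\infty}\bar{\boldsymbol{w}}(B)/B=\hat{\boldsymbol{u}}$, where $\hat{\boldsymbol{u}}=\arg\max_{\|\boldsymbol{u}\|=1}\min_{1\le i\le n}y_i\langle\boldsymbol{u},\boldsymbol{x}_i\rangle$ is the unique maximum-margin solution.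
   Context: $\|\cdot\|$ is the Euclidean norm. "Linearly separable" means there exist a unit vector $\boldsymbol{u}$ and $\gamma>0$ with $y_i\langle\boldsymbol{u},\boldsymbol{x}_i\rangle\ge\gamma$ for all $i$. "Strictly decreasing to $0$" means strictly decreasing with $\lim_{z\to\infty}\ell(z)=0$. Under these assumptions the infimum of $\mathcal{R}$ is not attained and $\bar{\boldsymbol{w}}(B)$ is unique. *)

theory Defs
  imports "HOL-Analysis.Analysis"
begin

definition linearly_separable :: "nat \<Rightarrow> (nat \<Rightarrow> real ^ 'd) \<Rightarrow> (nat \<Rightarrow> real) \<Rightarrow> bool"
  where "linearly_separable n x y \<longleftrightarrow>
    (\<exists>u \<gamma>. norm u = 1 \<and> \<gamma> > 0 \<and> (\<forall>i\<in>{1..n}. y i * (u \<bullet> x i) \<ge> \<gamma>))"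

definition risk :: "(real \<Rightarrow> real) \<Rightarrow> nat \<Rightarrow> (nat \<Rightarrow> real ^ 'd) \<Rightarrow> (nat \<Rightarrow> real) \<Rightarrow> real ^ 'd \<Rightarrow> real"
  where "risk loss n x y w = (1 / real n) * (\<Sum>i=1..n. loss (y i * (w \<bullet> x i)))"

definition margin :: "nat \<Rightarrow> (nat \<Rightarrow> real ^ 'd) \<Rightarrow> (nat \<Rightarrow> real) \<Rightarrow> real ^ 'd \<Rightarrow> real"
  where "margin n x y u = (MIN i\<in>{1..n}. y i * (u \<bullet> x i))"

(* ARG_MIN and ARG_MAX choose some optimizer and are meaningful only where one exists;
   a statement about w_bar or u_hat should settle existence and uniqueness as well. *)

definition w_bar :: "(real \<Rightarrow> real) \<Rightarrow> nat \<Rightarrow> (nat \<Rightarrow> real ^ 'd) \<Rightarrow> (nat \<Rightarrow> real) \<Rightarrow> real \<Rightarrow> real ^ 'd"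
  where "w_bar loss n x y B = (ARG_MIN (risk loss n x y) w. norm w \<le> B)"

definition u_hat :: "nat \<Rightarrow> (nat \<Rightarrow> real ^ 'd) \<Rightarrow> (nat \<Rightarrow> real) \<Rightarrow> real ^ 'd"
  where "u_hat n x y = (ARG_MAX (margin n x y) u. norm u = 1)"

end

theory Submission
  imports Defs
begin

text \<open>The margin is superadditive and positively homogeneous, so if \<open>g\<close> is its maximum on the unit
  sphere, attained at \<open>v\<close>, then every \<open>u\<close> in the unit ball satisfies
  \<open>margin u + g \<le> margin (u + v) \<le> g * norm (u + v)\<close>, and the parallelogram law turns
  this into \<open>(norm (u - v))\<^sup>2 \<le> 4 * (g - margin u) / g\<close>. For the constrained risk minimizer \<open>w\<close>,
  comparison with \<open>B *\<^sub>R v\<close> gives \<open>loss (margin w) \<le> n * loss (B * g)\<close>; as the loss is exponential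
  up to a factor 2, the margin of \<open>w\<close> is at least \<open>B * g - ln (4 * n) / b\<close>, which after division
  by \<open>B\<close> is \<open>g - O(1 / B)\<close>.\<close>

section \<open>Elementary properties of the margin\<close>

lemma margin_ge_iff:
  assumes "n \<ge> 1"
  shows "c \<le> margin n x y u \<longleftrightarrow> (\<forall>i\<in>{1..n}. c \<le> y i * (u \<bullet> x i))"
  unfolding margin_def using assms by (subst Min_ge_iff) auto

lemma margin_le: "i \<in> {1..n} \<Longrightarrow> margin n x y u \<le> y i * (u \<bullet> x i)"
  unfolding margin_def by (intro Min_le) auto

lemma margin_attained:
  assumes "n \<ge> 1"
  obtains i where "i \<in> {1..n}" "margin n x y u = y i * (u \<bullet> x i)"
proof -
  have "margin n x y u \<in> (\<lambda>i. y i * (u \<bullet> x i)) ` {1..n}"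
    unfolding margin_def using assms by (intro Min_in) auto
  then show thesis using that by auto
qed

lemma margin_superadditive:
  assumes "n \<ge> 1"
  shows "margin n x y u + margin n x y v \<le> margin n x y (u + v)"
  unfolding margin_ge_iff[OF assms]
  by (auto simp: inner_add_left distrib_left intro!: add_mono margin_le)

lemma margin_scaleR_ge:
  assumes "n \<ge> 1" "c \<ge> 0"
  shows "c * margin n x y u \<le> margin n x y (c *\<^sub>R u)"
  unfolding margin_ge_iff[OF assms(1)]
  using assms(2) by (auto simp: mult.left_commute[of _ c] intro!: mult_left_mono margin_le)

text \<open>With signs as labels and data in the unit ball, Cauchy-Schwarz makes each functional
  \<open>y i * (u \<bullet> x i)\<close> 1-Lipschitz in \<open>u\<close>, and a minimum of such
  functionals inherits this.\<close>

lemma margin_lipschitz: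
  assumes "n \<ge> 1" "\<forall>i\<in>{1..n}. norm (x i) \<le> 1" "\<forall>i\<in>{1..n}. y i \<in> {-1, 1}"
  shows "margin n x y u - norm (u - v) \<le> margin n x y v"
  unfolding margin_ge_iff[OF assms(1)]
proof
  fix i assume i: "i \<in> {1..n}"
  have "y i * ((u - v) \<bullet> x i) \<le> \<bar>y i\<bar> * \<bar>(u - v) \<bullet> x i\<bar>"
    by (metis abs_ge_self abs_mult)
  also have "\<dots> = \<bar>(u - v) \<bullet> x i\<bar>" using assms(3) i by force
  also have "\<dots> \<le> norm (u - v) * norm (x i)" by (rule Cauchy_Schwarz_ineq2)
  also have "\<dots> \<le> norm (u - v)" using assms(2) i by (simp add: mult_left_le)
  finally show "margin n x y u - norm (u - v) \<le> y i * (v \<bullet> x i)"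
    using margin_le[OF i, of x y u] by (simp add: inner_diff_left right_diff_distrib)
qed

lemma continuous_on_margin:
  assumes "n \<ge> 1" "\<forall>i\<in>{1..n}. norm (x i) \<le> 1" "\<forall>i\<in>{1..n}. y i \<in> {-1, 1}"
  shows "continuous_on S (margin n x y)"
proof -
  have "dist (margin n x y u) (margin n x y v) \<le> dist u v" for u v
    using margin_lipschitz[OF assms, of u v] margin_lipschitz[OF assms, of v u]
    by (auto simp: dist_norm norm_minus_commute abs_le_iff)
  then show ?thesis unfolding continuous_on_iff by (meson le_less_trans)
qed

section \<open>The maximum-margin direction\<close>

lemma margin_le_norm:
  assumes "n \<ge> 1" "is_arg_max (margin n x y) (\<lambda>u. norm u = 1) v"
  shows "margin n x y w \<le> margin n x y v * norm w"
proof (cases "w = 0")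
  case True
  then show ?thesis using margin_attained[OF assms(1), of x y w] by fastforce
next
  case False
  then have "inverse (norm w) * margin n x y w \<le> margin n x y (w /\<^sub>R norm w)"
    by (intro margin_scaleR_ge assms) auto
  also have "\<dots> \<le> margin n x y v"
    using assms(2) False unfolding is_arg_max_def by (simp add: not_less)
  finally show ?thesis using False by (simp add: field_simps)
qed

text \<open>This is uniqueness in quantitative form: gap zero forces \<open>u = v\<close>, and a
  small gap forces \<open>u\<close> close to \<open>v\<close>. The whole ball is allowed for
  \<open>u\<close> because a rescaled risk minimizer is only known to have norm at most 1.\<close>

lemma dist_max_margin_bound:
  assumes "n \<ge> 1" and v: "is_arg_max (margin n x y) (\<lambda>u. norm u = 1) v"
    and pos: "margin n x y v > 0" and u: "norm u \<le> 1"
  shows "(norm (u - v))\<^sup>2 \<le> 4 * (margin n x y v - margin n x y u) / margin n x y v"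
proof -
  define g where "g = margin n x y v"
  define t where "t = norm (u + v)"
  have "margin n x y u + g \<le> g * t"
    using margin_superadditive[OF assms(1), of x y u v] margin_le_norm[OF assms(1) v, of "u + v"]
    unfolding g_def t_def by linarith
  then have 1: "1 + margin n x y u / g \<le> t" using pos by (simp add: g_def field_simps)
  have "(norm (u - v))\<^sup>2 + t\<^sup>2 = 2 * (norm u)\<^sup>2 + 2 * (norm v)\<^sup>2"
    unfolding t_def by (simp add: power2_norm_eq_inner algebra_simps inner_commute)
  moreover have "norm v = 1" using v by (simp add: is_arg_max_def)
  moreover have "(norm u)\<^sup>2 \<le> 1" using u by (simp add: power_le_one)
  \<comment> \<open>The tangent to the square at 2, the value of \<open>t\<close> when
    \<open>u = v\<close>. Unlike squaring the lower bound for \<open>t\<close>, this needs no sign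
    condition on that bound, and it stays linear in the margin gap.\<close>
  moreover have "t\<^sup>2 \<ge> 4 * t - 4"
    using zero_le_power2[of "t - 2"] by (simp add: power2_diff)
  ultimately have "(norm (u - v))\<^sup>2 \<le> 8 - 4 * t" by simp
  also have "\<dots> \<le> 4 - 4 * (margin n x y u / g)" using 1 by simp
  also have "\<dots> = 4 * (g - margin n x y u) / g"
    using pos by (simp add: g_def field_simps)
  finally show ?thesis unfolding g_def .
qed

text \<open>Existence is compactness of the sphere, uniqueness is the distance bound with gap zero,
  and positivity is comparison with a separating vector.\<close>

lemma max_margin_exists_unique:
  assumes "n \<ge> 1" "\<forall>i\<in>{1..n}. norm (x i) \<le> 1" "\<forall>i\<in>{1..n}. y i \<in> {-1, 1}"
    and sep: "linearly_separable n x y"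
  shows "\<exists>!u. is_arg_max (margin n x y) (\<lambda>u. norm u = 1) u"
    and "is_arg_max (margin n x y) (\<lambda>u. norm u = 1) v \<Longrightarrow> margin n x y v > 0"
proof -
  obtain u0 c where u0: "norm u0 = 1" "c > 0" "\<forall>i\<in>{1..n}. y i * (u0 \<bullet> x i) \<ge> c"
    using sep unfolding linearly_separable_def by blast
  then have u0_pos: "margin n x y u0 > 0"
    using margin_ge_iff[OF assms(1), of c x y u0] by auto
  show pos: "margin n x y v > 0" if "is_arg_max (margin n x y) (\<lambda>u. norm u = 1) v" for v
    using that u0(1) u0_pos unfolding is_arg_max_def by force
  have "\<exists>v\<in>sphere 0 1. \<forall>u\<in>sphere 0 1. margin n x y u \<le> margin n x y v"
    using u0(1) by (intro continuous_attains_sup continuous_on_margin assms) auto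
  then obtain v where v: "is_arg_max (margin n x y) (\<lambda>u. norm u = 1) v"
    unfolding is_arg_max_def by (fastforce simp: not_less)
  show "\<exists>!u. is_arg_max (margin n x y) (\<lambda>u. norm u = 1) u"
  proof (rule ex1I, rule v)
    fix u assume u: "is_arg_max (margin n x y) (\<lambda>u. norm u = 1) u"
    then have "margin n x y u = margin n x y v" "norm u \<le> 1"
      using v unfolding is_arg_max_def by (auto simp: not_less intro: antisym)
    then show "u = v"
      using dist_max_margin_bound[OF assms(1) v pos[OF v], of u] by simp
  qed
qed

section \<open>The constrained risk minimizer\<close>

text \<open>Uniqueness comes from the rotundity of the ball: the midpoint of two distinct minimizers
  has no larger risk by convexity and lies strictly inside, so it can still be moved along a
  separating direction, which strictly lowers the risk.\<close>

lemma risk_minimizer_exists_unique: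
  assumes "n \<ge> 1" and sep: "linearly_separable n x y" and convex: "convex_on UNIV loss"
    and cont: "continuous_on UNIV loss" and anti: "strict_antimono_on UNIV loss" and "B \<ge> 0"
  shows "\<exists>!w. is_arg_min (risk loss n x y) (\<lambda>w. norm w \<le> B) w"
proof -
  obtain u0 c where u0: "norm u0 = 1" "c > 0" "\<forall>i\<in>{1..n}. y i * (u0 \<bullet> x i) \<ge> c"
    using sep unfolding linearly_separable_def by blast
  have decr: "risk loss n x y (w + t *\<^sub>R u0) < risk loss n x y w" if "t > 0" for w t
  proof -
    have "loss (y i * ((w + t *\<^sub>R u0) \<bullet> x i)) < loss (y i * (w \<bullet> x i))" if i: "i \<in> {1..n}" for i
    proof (rule monotone_onD[OF anti UNIV_I UNIV_I])
      have "y i * (u0 \<bullet> x i) > 0" using u0(2,3) i by fastforce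
      then have "t * (y i * (u0 \<bullet> x i)) > 0" using \<open>t > 0\<close> by simp
      then show "y i * (w \<bullet> x i) < y i * ((w + t *\<^sub>R u0) \<bullet> x i)"
        by (simp add: inner_add_left algebra_simps)
    qed
    then show ?thesis
      unfolding risk_def using assms(1)
      by (intro mult_strict_left_mono sum_strict_mono) auto
  qed
  have mid: "risk loss n x y ((1/2) *\<^sub>R (v + w)) \<le> (risk loss n x y v + risk loss n x y w) / 2" for v w
  proof -
    have "loss (y i * (((1/2) *\<^sub>R (v + w)) \<bullet> x i))
        \<le> (1/2) * loss (y i * (v \<bullet> x i)) + (1/2) * loss (y i * (w \<bullet> x i))" for i
      using convex_onD[OF convex, of "1/2" "y i * (v \<bullet> x i)" "y i * (w \<bullet> x i)"]
      by (simp add: inner_add_left algebra_simps)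
    then have "(\<Sum>i=1..n. loss (y i * (((1/2) *\<^sub>R (v + w)) \<bullet> x i)))
        \<le> (\<Sum>i=1..n. (1/2) * loss (y i * (v \<bullet> x i)) + (1/2) * loss (y i * (w \<bullet> x i)))"
      by (intro sum_mono)
    also have "\<dots> = ((\<Sum>i=1..n. loss (y i * (v \<bullet> x i))) + (\<Sum>i=1..n. loss (y i * (w \<bullet> x i)))) / 2"
      by (simp add: sum.distrib sum_divide_distrib[symmetric] add_divide_distrib)
    finally show ?thesis
      unfolding risk_def using assms(1) by (simp add: field_simps)
  qed
  have "continuous_on (cball 0 B) (risk loss n x y)"
    unfolding risk_def
    by (intro continuous_intros continuous_on_compose2[OF cont]) auto
  then have "\<exists>v\<in>cball 0 B. \<forall>w\<in>cball 0 B. risk loss n x y v \<le> risk loss n x y w"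
    using \<open>B \<ge> 0\<close> by (intro continuous_attains_inf) auto
  then obtain v where v: "is_arg_min (risk loss n x y) (\<lambda>w. norm w \<le> B) v"
    unfolding is_arg_min_def by (fastforce simp: not_less)
  show ?thesis
  proof (rule ex1I, rule v, rule ccontr)
    fix w assume w: "is_arg_min (risk loss n x y) (\<lambda>w. norm w \<le> B) w" and "w \<noteq> v"
    define m where "m = (1/2) *\<^sub>R (v + w)"
    have eq: "risk loss n x y w = risk loss n x y v" and nv: "norm v \<le> B" and nw: "norm w \<le> B"
      using v w unfolding is_arg_min_def by (auto simp: not_less intro: antisym)
    \<comment> \<open>The parallelogram law puts the midpoint strictly inside the ball.\<close>
    have "4 * (norm m)\<^sup>2 + (norm (v - w))\<^sup>2 = 2 * (norm v)\<^sup>2 + 2 * (norm w)\<^sup>2"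
      unfolding m_def by (simp add: power2_norm_eq_inner algebra_simps inner_commute)
    moreover have "(norm v)\<^sup>2 \<le> B\<^sup>2" "(norm w)\<^sup>2 \<le> B\<^sup>2" using nv nw by (simp_all add: power_mono)
    moreover have "(norm (v - w))\<^sup>2 > 0" using \<open>w \<noteq> v\<close> by simp
    ultimately have "(norm m)\<^sup>2 < B\<^sup>2" by linarith
    then have m: "norm m < B" using \<open>B \<ge> 0\<close> by (rule power2_less_imp_less)
    \<comment> \<open>Since \<open>u0\<close> is a unit vector, the step \<open>B - norm m\<close>
      uses up exactly the slack left by the triangle inequality.\<close>
    have "norm (m + (B - norm m) *\<^sub>R u0) \<le> B"
      using norm_triangle_ineq[of m "(B - norm m) *\<^sub>R u0"] m u0(1) by simp
    then have "risk loss n x y v \<le> risk loss n x y (m + (B - norm m) *\<^sub>R u0)"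
      using v unfolding is_arg_min_def by (simp add: not_less)
    also have "\<dots> < risk loss n x y m" using m by (intro decr) simp
    also have "\<dots> \<le> risk loss n x y v" using mid[of v w] eq by (simp add: m_def)
    finally show False by simp
  qed
qed

section \<open>Lower bound for the margin of the minimizer\<close>

text \<open>By nonnegativity the summand at which the margin of \<open>w\<close> is attained is at
  most the whole sum. Minimality passes to the sum for \<open>v\<close>, whose \<open>n\<close>
  terms are each at most the loss at the margin of \<open>v\<close>.\<close>

lemma loss_margin_minimizer_le:
  assumes "n \<ge> 1" and anti: "antimono loss" and nonneg: "\<And>z. loss z \<ge> 0"
    and w: "is_arg_min (risk loss n x y) (\<lambda>w. norm w \<le> B) w" and v: "norm v \<le> B"
  shows "loss (margin n x y w) \<le> real n * loss (margin n x y v)"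
proof -
  obtain i where i: "i \<in> {1..n}" "margin n x y w = y i * (w \<bullet> x i)"
    using margin_attained[OF assms(1)] by blast
  have "loss (margin n x y w) \<le> (\<Sum>i=1..n. loss (y i * (w \<bullet> x i)))"
    unfolding i(2) using i(1) by (intro member_le_sum nonneg) auto
  also have "\<dots> \<le> (\<Sum>i=1..n. loss (y i * (v \<bullet> x i)))"
    using w v assms(1) unfolding is_arg_min_def risk_def
    by (auto simp: not_less divide_le_cancel)
  also have "\<dots> \<le> (\<Sum>i=1..n. loss (margin n x y v))"
    by (intro sum_mono antimonoD[OF anti] margin_le)
  finally show ?thesis by simp
qed

text \<open>Once \<open>m B\<close> and \<open>B * g\<close> both lie in the tail, the hypothesis
  compares two exponentials up to a constant, and taking logarithms leaves a constant additive gap.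
  It is applied with \<open>m B\<close> the margin of the minimizer and \<open>N\<close> the sample
  size.\<close>

lemma exponential_tail_gap:
  fixes loss :: "real \<Rightarrow> real" and m :: "real \<Rightarrow> real"
  assumes "a > 0" "b > 0" "g > 0" "N > 0"
    and anti: "antimono loss" and pos: "\<And>z. loss z > 0" and lim0: "(loss \<longlongrightarrow> 0) at_top"
    and tail: "((\<lambda>z. loss z / (a * exp (- b * z))) \<longlongrightarrow> 1) at_top"
    and le: "\<forall>\<^sub>F B in at_top. loss (m B) \<le> N * loss (B * g)"
  shows "\<forall>\<^sub>F B in at_top. m B \<ge> B * g - ln (4 * N) / b"
proof -
  have "\<forall>\<^sub>F z in at_top. loss z / (a * exp (- b * z)) > 1/2 \<and> loss z / (a * exp (- b * z)) < 2"
    using order_tendstoD(1)[OF tail, of "1/2"] order_tendstoD(2)[OF tail, of 2]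
    by (auto elim: eventually_elim2)
  then obtain Z where Z: "\<And>z. z \<ge> Z \<Longrightarrow> a * exp (- b * z) < 2 * loss z"
      "\<And>z. z \<ge> Z \<Longrightarrow> loss z < 2 * (a * exp (- b * z))"
    using \<open>a > 0\<close> unfolding eventually_at_top_linorder by (auto simp: field_simps)
  have lin: "filterlim (\<lambda>B. B * g) at_top at_top"
    using \<open>g > 0\<close> by (intro filterlim_at_top_mult_tendsto_pos[OF tendsto_const] filterlim_ident)
  have "((\<lambda>B. N * loss (B * g)) \<longlongrightarrow> N * 0) at_top"
    by (intro tendsto_intros filterlim_compose[OF lim0 lin])
  \<comment> \<open>This will force \<open>m B\<close> into the tail: \<open>m B < Z\<close> would
    give \<open>loss (m B) \<ge> loss Z\<close>.\<close>
  then have "\<forall>\<^sub>F B in at_top. N * loss (B * g) < loss Z"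
    using pos by (intro order_tendstoD) auto
  moreover have "\<forall>\<^sub>F B in at_top. B * g \<ge> Z"
    using lin unfolding filterlim_at_top by blast
  ultimately show ?thesis using le
  proof eventually_elim
    case (elim B)
    have "m B \<ge> Z"
      using antimonoD[OF anti, of "m B" Z] elim by linarith
    then have "a * exp (- b * m B) < 2 * loss (m B)" by (rule Z)
    also have "\<dots> \<le> 2 * (N * loss (B * g))" using elim by simp
    \<comment> \<open>The two-sided tail estimate costs a factor 2 at each of the two points, hence
      the constant \<open>4 * N\<close>.\<close>
    also have "\<dots> \<le> 2 * (N * (2 * (a * exp (- b * (B * g)))))"
      using Z(2)[OF elim(2)] \<open>N > 0\<close> by simp
    also have "\<dots> = a * (exp (ln (4 * N)) * exp (- b * (B * g)))" using \<open>N > 0\<close> by simp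
    finally have "exp (- b * m B) < exp (ln (4 * N) + (- b * (B * g)))"
      using \<open>a > 0\<close> unfolding exp_add by simp
    then have "- b * m B < ln (4 * N) + (- b * (B * g))" unfolding exp_less_cancel_iff .
    then have "b * (B * g) - ln (4 * N) \<le> b * m B" by simp
    then show ?case using \<open>b > 0\<close> by (simp add: field_simps)
  qed
qed

section \<open>Convergence in direction\<close>

theorem proposition10:
  fixes n :: nat and x :: "nat \<Rightarrow> real ^ 'd" and y :: "nat \<Rightarrow> real"
    and loss :: "real \<Rightarrow> real" and a b :: real
  assumes "n \<ge> 1"
    and "\<forall>i\<in>{1..n}. norm (x i) \<le> 1"
    and "\<forall>i\<in>{1..n}. y i \<in> {-1, 1}"
    and "linearly_separable n x y"
    and "convex_on UNIV loss"
    and "\<forall>z. loss differentiable (at z)"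
    and "strict_antimono_on UNIV loss"
    and "(loss \<longlongrightarrow> 0) at_top"
    and "a > 0" and "b > 0"
    and "((\<lambda>z. loss z / (a * exp (- b * z))) \<longlongrightarrow> 1) at_top"
  shows "(\<forall>B>0. \<exists>!w. is_arg_min (risk loss n x y) (\<lambda>w. norm w \<le> B) w)
    \<and> (\<exists>!u. is_arg_max (margin n x y) (\<lambda>u. norm u = 1) u)
    \<and> ((\<lambda>B. w_bar loss n x y B /\<^sub>R B) \<longlongrightarrow> u_hat n x y) at_top"
proof (intro conjI)
  have "continuous_on UNIV loss"
    using assms(6) by (auto intro!: continuous_at_imp_continuous_on differentiable_imp_continuous_within)
  then have risk_ex1: "\<exists>!w. is_arg_min (risk loss n x y) (\<lambda>w. norm w \<le> B) w" if "B > 0" for B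
    using that assms by (intro risk_minimizer_exists_unique) auto
  then show "\<forall>B>0. \<exists>!w. is_arg_min (risk loss n x y) (\<lambda>w. norm w \<le> B) w" by blast
  show ex1: "\<exists>!u. is_arg_max (margin n x y) (\<lambda>u. norm u = 1) u"
    using assms by (intro max_margin_exists_unique)
  define v where "v = u_hat n x y"
  define g where "g = margin n x y v"
  define w where "w = w_bar loss n x y"
  \<comment> \<open>Existence of optimizers makes the choices behind \<open>u_hat\<close> and
    \<open>w_bar\<close> genuine optimizers.\<close>
  have v: "is_arg_max (margin n x y) (\<lambda>u. norm u = 1) v"
    unfolding v_def u_hat_def arg_max_def using ex1 by (metis someI_ex)
  have w: "is_arg_min (risk loss n x y) (\<lambda>w. norm w \<le> B) (w B)" if "B > 0" for B
    unfolding w_def w_bar_def arg_min_def using risk_ex1[OF that] by (metis someI_ex)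
  have "g > 0"
    unfolding g_def using assms v by (intro max_margin_exists_unique(2))
  have anti: "antimono loss"
    using monotone_onD[OF assms(7)] by (intro antimonoI) (metis UNIV_I le_less)
  \<comment> \<open>A decreasing function lies above its limit at infinity; strictness, used between
    \<open>z\<close> and \<open>z + 1\<close>, then gives positivity.\<close>
  have nonneg: "loss z \<ge> 0" for z
    by (intro tendsto_upperbound[OF assms(8)] eventually_mono[OF eventually_ge_at_top[of z]])
       (auto intro: antimonoD[OF anti])
  have pos: "loss z > 0" for z
    using monotone_onD[OF assms(7), of z "z + 1"] nonneg[of "z + 1"] by simp
  \<comment> \<open>The competitor is \<open>B *\<^sub>R v\<close>, feasible because
    \<open>v\<close> has norm 1.\<close>
  have "\<forall>\<^sub>F B in at_top. loss (margin n x y (w B)) \<le> real n * loss (B * g)"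
    using eventually_gt_at_top[of "0::real"]
  proof eventually_elim
    case (elim B)
    have "loss (margin n x y (w B)) \<le> real n * loss (margin n x y (B *\<^sub>R v))"
      using v elim by (intro loss_margin_minimizer_le[OF assms(1) anti nonneg w[OF elim]])
        (simp add: is_arg_max_def)
    also have "\<dots> \<le> real n * loss (B * g)"
      unfolding g_def using elim assms(1)
      by (intro mult_left_mono antimonoD[OF anti] margin_scaleR_ge) auto
    finally show ?case .
  qed
  then have "\<forall>\<^sub>F B in at_top. margin n x y (w B) \<ge> B * g - ln (4 * real n) / b"
    using assms \<open>g > 0\<close> pos anti by (intro exponential_tail_gap) auto
  then have "\<forall>\<^sub>F B in at_top. (norm (w B /\<^sub>R B - v))\<^sup>2 \<le> (4 * ln (4 * real n) / (b * g)) / B"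
    using eventually_gt_at_top[of "0::real"]
  proof eventually_elim
    case (elim B)
    have "g - ln (4 * real n) / b / B = inverse B * (B * g - ln (4 * real n) / b)"
      using elim by (simp add: field_simps)
    also have "\<dots> \<le> inverse B * margin n x y (w B)"
      using elim by (intro mult_left_mono) auto
    also have "\<dots> \<le> margin n x y (w B /\<^sub>R B)"
      using elim by (intro margin_scaleR_ge assms) auto
    finally have gap: "g - margin n x y (w B /\<^sub>R B) \<le> ln (4 * real n) / b / B" by simp
    have "norm (w B /\<^sub>R B) \<le> 1"
      using w[OF elim(2)] elim by (simp add: is_arg_min_def field_simps)
    then have "(norm (w B /\<^sub>R B - v))\<^sup>2 \<le> 4 * (g - margin n x y (w B /\<^sub>R B)) / g"
      using dist_max_margin_bound[OF assms(1) v] \<open>g > 0\<close> unfolding g_def by blast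
    also have "\<dots> \<le> 4 * (ln (4 * real n) / b / B) / g"
      using gap \<open>g > 0\<close> by (intro divide_right_mono mult_left_mono) auto
    finally show ?case by (simp add: field_simps)
  qed
  moreover have "((\<lambda>B. (4 * ln (4 * real n) / (b * g)) / B) \<longlongrightarrow> 0) at_top"
    by (intro tendsto_divide_0[OF tendsto_const] filterlim_at_top_imp_at_infinity filterlim_ident)
  \<comment> \<open>The squared distance is squeezed between 0 and a constant over
    \<open>B\<close>.\<close>
  ultimately have "((\<lambda>B. (norm (w B /\<^sub>R B - v))\<^sup>2) \<longlongrightarrow> 0) at_top"
    by (rule tendsto_sandwich[OF _ _ tendsto_const, rotated]) auto
  from tendsto_real_sqrt[OF this] have "((\<lambda>B. norm (w B /\<^sub>R B - v)) \<longlongrightarrow> 0) at_top"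
    by simp
  then show "((\<lambda>B. w_bar loss n x y B /\<^sub>R B) \<longlongrightarrow> u_hat n x y) at_top"
    unfolding v_def[symmetric] w_def[symmetric]
    by (rule LIM_zero_cancel[OF tendsto_norm_zero_cancel])
qed

end
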